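(* Let $p_2\ne0$, $p_3>0$, $|p_2|\ne p_3$, $\rho>0$, and consider the system $$\mathcal{D}'=2(p_2-p_3)\mathcal{R}\mathcal{I},\qquad\mathcal{R}'=-2(p_2+p_3)\mathcal{D}\mathcal{I},\qquad\mathcal{I}'=4p_3\mathcal{D}\mathcal{R}$$ on $S^2_\rho$. The six points $\pm(\rho,0,0),\pm(0,\rho,0),\pm(0,0,\rho)$ are fixed points. In the other case (initial data in $S_\rho^2$ different from these points), the triplet $$(f,g,h)=\begin{cases}\big(-\sqrt{8p_3|p_2+p_3|}\,\mathcal{D},\ \sqrt{8p_3(p_3-p_2)}\,\mathcal{R},\ 2\sqrt{p_2^2-p_3^2}\,\mathcal{I}\big)&\text{if }p_2<-p_3,\\ \big(2\sqrt{p_3^2-p_2^2}\,\mathcal{I},\ \sqrt{8p_3(p_3-p_2)}\,\mathcal{R},\ \sqrt{8p_3(p_2+p_3)}\,\mathcal{D}\big)&\text{if }-p_3<p_2<p_3,\\ \big(-\sqrt{8p_3(p_2-p_3)}\,\mathcal{R},\ \sqrt{8p_3(p_2+p_3)}\,\mathcal{D},\ 2\sqrt{p_2^2-p_3^2}\,\mathcal{I}\big)&\text{if }p_3<p_2\end{cases}$$ solves $$f'=gh,\qquad g'=-fh,\qquad h'=-fg,$$ and hence the solution $(\mathcal{D},\mathcal{R},\mathcal{I})$ is given explicitly through the following formulas. Let $(f_0,g_0,h_0)$ be the value of $(f,g,h)$ at time $0$, $R_{fg}=\sqrt{f_0^2+g_0^2}$, $R_{fh}=\sqrt{f_0^2+h_0^2}$,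 and suppose $R_{fh}\ge R_{fg}$. (i) If $R_{fg}=0$, then $f(t)=0$, $g(t)=0$, $h(t)=h_0$. (ii) If $R_{fh}>R_{fg}>0$, then $h_0\ne0$ and, with $m=R_{fg}^2/R_{fh}^2$ and $\varsigma=\operatorname{sign}h_0$, $$f(t)=R_{fg}\operatorname{sn}(\varsigma R_{fh}t+t_0,m),\quad g(t)=R_{fg}\operatorname{cn}(\varsigma R_{fh}t+t_0,m),\quad h(t)=\varsigma R_{fh}\operatorname{dn}(\varsigma R_{fh}t+t_0,m),$$ where $t_0$ is given by $(\operatorname{sn}(t_0,m),\operatorname{cn}(t_0,m))=(f_0/R_{fg},g_0/R_{fg})$. (iii) If $R_{fh}=R_{fg}>0$ and $g_0=h_0=0$, then $f(t)=f_0$, $g(t)=0$, $h(t)=0$. (iv) If $R_{fh}=R_{fg}>0$ and $g_0\ne0$, then $|h_0|=|g_0|>0$ and, with $\varsigma=\operatorname{sign}(g_0h_0)$ and $t_0=\tanh^{-1}(f_0/R_{fh})$, $$f(t)=R_{fh}\tanh(\varsigma R_{fh}t+t_0),\quad g(t)=(\operatorname{sign}g_0)R_{fh}\operatorname{sech}(\varsigma R_{fh}t+t_0),\quad h(t)=(\operatorname{sign}h_0)R_{fh}\operatorname{sech}(\varsigma R_{fh}t+t_0).$$ In all cases $f^2+g^2$ and $f^2+h^2$ are conserved; the formula in the case $R_{fh}<R_{fg}$ is obtained by swapping the roles of $g$ and $h$.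
   Context: $S^2_\rho=\{(x,y,z)\in\mathbb{R}^3: x^2+y^2+z^2=\rho^2\}$; the unknown $(\mathcal{D},\mathcal{R},\mathcal{I})$ is real valued, and the system preserves $S^2_\rho$. Jacobi elliptic functions with parameter $m\in[0,1)$: for $u\in\mathbb{R}$ define $\phi$ by $u=\int_0^\phi\frac{d\theta}{\sqrt{1-m\sin^2\theta}}$; then $\operatorname{sn}(u,m)=\sin\phi$, $\operatorname{cn}(u,m)=\cos\phi$, $\operatorname{dn}(u,m)=\sqrt{1-m\sin^2\phi}$. *)

theory Defs
  imports "HOL-Analysis.Analysis"
begin

section \<open>Jacobi elliptic functions\<close>

text \<open>
  The interval integral is oriented, so negative amplitudes are covered. For \<open>0 \<le> m < 1\<close> the integral
  is a strictly increasing bijection of the real line as a function of its upper bound, hence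
  the description below is then uniquely satisfied; other parameters are never used.
\<close>

definition jacobi_am :: "real \<Rightarrow> real \<Rightarrow> real" where
  "jacobi_am u m =
     (THE \<phi>. u = (LBINT \<theta>=ereal 0..ereal \<phi>. 1 / sqrt (1 - m * (sin \<theta>)\<^sup>2)))"

definition jacobi_sn :: "real \<Rightarrow> real \<Rightarrow> real" where
  "jacobi_sn u m = sin (jacobi_am u m)"

definition jacobi_cn :: "real \<Rightarrow> real \<Rightarrow> real" where
  "jacobi_cn u m = cos (jacobi_am u m)"

definition jacobi_dn :: "real \<Rightarrow> real \<Rightarrow> real" where
  "jacobi_dn u m = sqrt (1 - m * (sin (jacobi_am u m))\<^sup>2)"

definition sech :: "real \<Rightarrow> real" where
  "sech x = 1 / cosh x"

section \<open>The two systems\<close>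

definition S2 :: "real \<Rightarrow> (real \<times> real \<times> real) set" where
  "S2 \<rho> = {(x, y, z). x\<^sup>2 + y\<^sup>2 + z\<^sup>2 = \<rho>\<^sup>2}"

definition axis_points :: "real \<Rightarrow> (real \<times> real \<times> real) set" where
  "axis_points \<rho> =
     {(\<rho>, 0, 0), (-\<rho>, 0, 0), (0, \<rho>, 0), (0, -\<rho>, 0), (0, 0, \<rho>), (0, 0, -\<rho>)}"

text \<open>At endpoints belonging to the time interval \<open>J\<close> the derivatives are one-sided.\<close>

definition DRI_solution ::
  "real \<Rightarrow> real \<Rightarrow> real set \<Rightarrow> (real \<Rightarrow> real) \<Rightarrow> (real \<Rightarrow> real) \<Rightarrow> (real \<Rightarrow> real) \<Rightarrow> bool" where
  "DRI_solution p2 p3 J D R I \<longleftrightarrow>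
     (\<forall>t\<in>J.
        (D has_real_derivative 2 * (p2 - p3) * R t * I t) (at t within J) \<and>
        (R has_real_derivative - 2 * (p2 + p3) * D t * I t) (at t within J) \<and>
        (I has_real_derivative 4 * p3 * D t * R t) (at t within J))"

definition DRI_fixed_point :: "real \<Rightarrow> real \<Rightarrow> real \<times> real \<times> real \<Rightarrow> bool" where
  "DRI_fixed_point p2 p3 P \<longleftrightarrow>
     (case P of (x, y, z) \<Rightarrow> DRI_solution p2 p3 UNIV (\<lambda>t. x) (\<lambda>t. y) (\<lambda>t. z))"

definition fgh_solution ::
  "real set \<Rightarrow> (real \<Rightarrow> real) \<Rightarrow> (real \<Rightarrow> real) \<Rightarrow> (real \<Rightarrow> real) \<Rightarrow> bool" where
  "fgh_solution J f g h \<longleftrightarrow>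
     (\<forall>t\<in>J.
        (f has_real_derivative g t * h t) (at t within J) \<and>
        (g has_real_derivative - (f t * h t)) (at t within J) \<and>
        (h has_real_derivative - (f t * g t)) (at t within J))"

text \<open>The last branch is meant for \<open>p3 < p2\<close>; the values \<open>\<bar>p2\<bar> = p3\<close> are never used.\<close>

definition fgh_triplet ::
  "real \<Rightarrow> real \<Rightarrow> real \<times> real \<times> real \<Rightarrow> real \<times> real \<times> real" where
  "fgh_triplet p2 p3 P =
     (case P of (D, R, I) \<Rightarrow>
       if p2 < - p3 then
         (- sqrt (8 * p3 * \<bar>p2 + p3\<bar>) * D,
          sqrt (8 * p3 * (p3 - p2)) * R,
          2 * sqrt (p2\<^sup>2 - p3\<^sup>2) * I)
       else if - p3 < p2 \<and> p2 < p3 then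
         (2 * sqrt (p3\<^sup>2 - p2\<^sup>2) * I,
          sqrt (8 * p3 * (p3 - p2)) * R,
          sqrt (8 * p3 * (p2 + p3)) * D)
       else
         (- sqrt (8 * p3 * (p2 - p3)) * R,
          sqrt (8 * p3 * (p2 + p3)) * D,
          2 * sqrt (p2\<^sup>2 - p3\<^sup>2) * I))"

section \<open>The explicit formulas\<close>

text \<open>
  The formulas for initial values with \<open>R_fh \<ge> R_fg\<close>. In the second case the phase \<open>t0\<close> is
  determined only up to a period of the elliptic functions: it exists, and every choice of it
  gives the formulas.
\<close>

definition explicit_formulas ::
  "real set \<Rightarrow> (real \<Rightarrow> real) \<Rightarrow> (real \<Rightarrow> real) \<Rightarrow> (real \<Rightarrow> real) \<Rightarrow> bool" where
  "explicit_formulas J f g h \<longleftrightarrow>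
    (let f0 = f 0; g0 = g 0; h0 = h 0;
         R_fg = sqrt (f0\<^sup>2 + g0\<^sup>2); R_fh = sqrt (f0\<^sup>2 + h0\<^sup>2)
     in
      (R_fg = 0 \<longrightarrow>
         (\<forall>t\<in>J. f t = 0 \<and> g t = 0 \<and> h t = h0)) \<and>
      (R_fh > R_fg \<and> R_fg > 0 \<longrightarrow>
         h0 \<noteq> 0 \<and>
         (let m = R_fg\<^sup>2 / R_fh\<^sup>2; \<sigma> = sgn h0;
              phase = (\<lambda>t0. jacobi_sn t0 m = f0 / R_fg \<and> jacobi_cn t0 m = g0 / R_fg)
          in
           (\<exists>t0. phase t0) \<and>
           (\<forall>t0. phase t0 \<longrightarrow>
              (\<forall>t\<in>J.
                 f t = R_fg * jacobi_sn (\<sigma> * R_fh * t + t0) m \<and>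
                 g t = R_fg * jacobi_cn (\<sigma> * R_fh * t + t0) m \<and>
                 h t = \<sigma> * R_fh * jacobi_dn (\<sigma> * R_fh * t + t0) m)))) \<and>
      (R_fh = R_fg \<and> R_fg > 0 \<and> g0 = 0 \<and> h0 = 0 \<longrightarrow>
         (\<forall>t\<in>J. f t = f0 \<and> g t = 0 \<and> h t = 0)) \<and>
      (R_fh = R_fg \<and> R_fg > 0 \<and> g0 \<noteq> 0 \<longrightarrow>
         \<bar>h0\<bar> = \<bar>g0\<bar> \<and> \<bar>g0\<bar> > 0 \<and>
         (let \<sigma> = sgn (g0 * h0); t0 = artanh (f0 / R_fh)
          in
           \<forall>t\<in>J.
             f t = R_fh * tanh (\<sigma> * R_fh * t + t0) \<and>
             g t = sgn g0 * R_fh * sech (\<sigma> * R_fh * t + t0) \<and>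
             h t = sgn h0 * R_fh * sech (\<sigma> * R_fh * t + t0))))"

definition explicitly_given ::
  "real set \<Rightarrow> (real \<Rightarrow> real) \<Rightarrow> (real \<Rightarrow> real) \<Rightarrow> (real \<Rightarrow> real) \<Rightarrow> bool" where
  "explicitly_given J f g h \<longleftrightarrow>
    (let R_fg = sqrt ((f 0)\<^sup>2 + (g 0)\<^sup>2); R_fh = sqrt ((f 0)\<^sup>2 + (h 0)\<^sup>2)
     in
      (R_fh \<ge> R_fg \<longrightarrow> explicit_formulas J f g h) \<and>
      (R_fh < R_fg \<longrightarrow> explicit_formulas J f h g))"

definition fgh_conserved ::
  "real set \<Rightarrow> (real \<Rightarrow> real) \<Rightarrow> (real \<Rightarrow> real) \<Rightarrow> (real \<Rightarrow> real) \<Rightarrow> bool" where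
  "fgh_conserved J f g h \<longleftrightarrow>
     (\<forall>t\<in>J. (f t)\<^sup>2 + (g t)\<^sup>2 = (f 0)\<^sup>2 + (g 0)\<^sup>2 \<and>
             (f t)\<^sup>2 + (h t)\<^sup>2 = (f 0)\<^sup>2 + (h 0)\<^sup>2)"

end

theory Submission
  imports Defs
begin

text \<open>The amplitude is the inverse of the incomplete elliptic integral, so its derivative is \<open>dn\<close>
  and the explicit formulas are seen to solve the system for \<open>(f, g, h)\<close> by differentiation. The
  quadratic invariants bound \<open>f\<close>, and the squared distance \<open>E\<close> of two solutions satisfies
  \<open>E' = - 2 (g - G) (h - H) (f + F)\<close>, hence \<open>\<bar>E'\<bar> \<le> K E\<close>; so a solution is determined by its initial
  value and agrees with the explicit one. Inverting the linear map from \<open>(D, R, I)\<close> to \<open>(f, g, h)\<close>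
  transfers global existence to the original system.\<close>

section \<open>The Jacobi amplitude\<close>

text \<open>The incomplete elliptic integral of the first kind, written exactly as inside
  \<open>jacobi_am\<close>, so that the amplitude unfolds to the inverse of
  \<open>elliptic_F m\<close>.\<close>

definition elliptic_F :: "real \<Rightarrow> real \<Rightarrow> real" where
  "elliptic_F m \<phi> = (LBINT \<theta>=ereal 0..ereal \<phi>. 1 / sqrt (1 - m * (sin \<theta>)\<^sup>2))"

lemma one_minus_sin_pos:
  fixes m :: real
  assumes "0 \<le> m" "m < 1"
  shows "0 < 1 - m * (sin x)\<^sup>2"
proof -
  have "(sin x)\<^sup>2 \<le> 1"
    by (simp add: abs_square_le_1)
  then have "m * (sin x)\<^sup>2 \<le> m * 1"
    using assms by (intro mult_left_mono)
  then show ?thesis using assms by simp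
qed

lemma elliptic_F_has_derivative:
  assumes "0 \<le> m" "m < 1"
  shows "(elliptic_F m has_real_derivative 1 / sqrt (1 - m * (sin x)\<^sup>2)) (at x)"
proof -
  \<comment> \<open>The margins of 1 make \<open>x\<close> interior to an interval that also
    contains the base point 0, whatever the sign of \<open>x\<close>; the derivative within the
    interval is then two-sided.\<close>
  define a where "a = min 0 x - 1"
  define b where "b = max 0 x + 1"
  have ab: "a \<le> 0" "0 \<le> b" "a < x" "x < b"
    by (auto simp: a_def b_def)
  have "continuous_on {a..b} (\<lambda>\<theta>. 1 / sqrt (1 - m * (sin \<theta>)\<^sup>2))"
    using one_minus_sin_pos[OF assms] by (intro continuous_intros) (simp add: less_imp_neq[symmetric])
  from interval_integral_FTC2[OF _ _ this, of 0 x] ab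
  have "(elliptic_F m has_real_derivative 1 / sqrt (1 - m * (sin x)\<^sup>2)) (at x within {a..b})"
    by (simp add: has_real_derivative_iff_has_vector_derivative elliptic_F_def[abs_def])
  moreover have "at x within {a..b} = at x"
    using ab by (intro at_within_interior) simp
  ultimately show ?thesis by simp
qed

lemma elliptic_F_0 [simp]: "elliptic_F m 0 = 0"
  by (simp add: elliptic_F_def)

lemma elliptic_F_strict_mono:
  assumes "0 \<le> m" "m < 1" "x < y"
  shows "elliptic_F m x < elliptic_F m y"
  using assms(3)
proof (rule DERIV_pos_imp_increasing)
  fix z
  show "\<exists>d. DERIV (elliptic_F m) z :> d \<and> 0 < d"
    using elliptic_F_has_derivative[OF assms(1,2)] one_minus_sin_pos[OF assms(1,2)]
    by (intro exI[of _ "1 / sqrt (1 - m * (sin z)\<^sup>2)"]) simp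
qed

text \<open>The integrand is at least 1, which gives surjectivity.\<close>

lemma elliptic_F_expanding:
  assumes "0 \<le> m" "m < 1" "x \<le> y"
  shows "y - x \<le> elliptic_F m y - elliptic_F m x"
proof -
  have "elliptic_F m x - x \<le> elliptic_F m y - y"
    using assms(3)
  proof (rule DERIV_nonneg_imp_nondecreasing)
    fix z
    have "sqrt (1 - m * (sin z)\<^sup>2) \<le> 1"
      using assms by simp
    then have "0 \<le> 1 / sqrt (1 - m * (sin z)\<^sup>2) - 1"
      using one_minus_sin_pos[OF assms(1,2)] by simp
    moreover have "DERIV (\<lambda>x. elliptic_F m x - x) z :> 1 / sqrt (1 - m * (sin z)\<^sup>2) - 1"
      using elliptic_F_has_derivative[OF assms(1,2)] by (intro derivative_intros)
    ultimately show "\<exists>d. DERIV (\<lambda>x. elliptic_F m x - x) z :> d \<and> 0 \<le> d"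
      by blast
  qed
  then show ?thesis by simp
qed

lemma elliptic_F_jacobi_am:
  assumes "0 \<le> m" "m < 1"
  shows "elliptic_F m (jacobi_am u m) = u"
proof -
  \<comment> \<open>Since \<open>elliptic_F m 0 = 0\<close> and the integral is expanding, its
    values at the ends of this interval enclose \<open>u\<close>.\<close>
  have "\<exists>x. - \<bar>u\<bar> \<le> x \<and> x \<le> \<bar>u\<bar> \<and> elliptic_F m x = u"
  proof (rule IVT')
    show "elliptic_F m (- \<bar>u\<bar>) \<le> u" "u \<le> elliptic_F m \<bar>u\<bar>"
      using elliptic_F_expanding[OF assms, of "-\<bar>u\<bar>" 0] elliptic_F_expanding[OF assms, of 0 "\<bar>u\<bar>"]
      by auto
    show "continuous_on {- \<bar>u\<bar>..\<bar>u\<bar>} (elliptic_F m)"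
      using elliptic_F_has_derivative[OF assms] by (rule DERIV_atLeastAtMost_imp_continuous_on[OF exI])
  qed simp
  then obtain x where x: "u = elliptic_F m x" by metis
  \<comment> \<open>Strict monotonicity makes the preimage unique, so the definite description in
    \<open>jacobi_am\<close> denotes it.\<close>
  have "u = elliptic_F m (THE \<phi>. u = elliptic_F m \<phi>)"
    by (rule theI[of _ x]) (use x elliptic_F_strict_mono[OF assms] in \<open>metis linorder_neqE less_irrefl\<close>)+
  then show ?thesis by (simp add: jacobi_am_def elliptic_F_def)
qed

lemma jacobi_am_elliptic_F:
  assumes "0 \<le> m" "m < 1"
  shows "jacobi_am (elliptic_F m x) m = x"
  using elliptic_F_jacobi_am[OF assms] elliptic_F_strict_mono[OF assms]
  by (metis linorder_neqE less_irrefl)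

section \<open>Derivatives of the Jacobi functions and existence of phases\<close>

lemma jacobi_am_has_derivative:
  assumes "0 \<le> m" "m < 1"
  shows "((\<lambda>u. jacobi_am u m) has_real_derivative jacobi_dn u m) (at u)"
proof -
  \<comment> \<open>The inverse of an expanding map is 1-Lipschitz; this supplies the continuity
    that the inverse function rule asks for.\<close>
  have "\<bar>jacobi_am v m - jacobi_am u m\<bar> \<le> \<bar>v - u\<bar>" for v
    using elliptic_F_expanding[OF assms, of "jacobi_am v m" "jacobi_am u m"]
      elliptic_F_expanding[OF assms, of "jacobi_am u m" "jacobi_am v m"]
    by (auto simp: elliptic_F_jacobi_am[OF assms] abs_if split: if_splits)
  then have "isCont (\<lambda>u. jacobi_am u m) u"
    unfolding continuous_at_eps_delta by (metis dist_real_def order_le_less_trans)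
  then have "DERIV (\<lambda>u. jacobi_am u m) u :> inverse (1 / sqrt (1 - m * (sin (jacobi_am u m))\<^sup>2))"
    by (intro DERIV_inverse_function[OF elliptic_F_has_derivative[OF assms], where a = "u - 1" and b = "u + 1"])
      (use one_minus_sin_pos[OF assms, of "jacobi_am u m"] elliptic_F_jacobi_am[OF assms] in auto)
  then show ?thesis by (simp add: jacobi_dn_def)
qed

lemma jacobi_dn_has_derivative:
  assumes "0 \<le> m" "m < 1"
  shows "((\<lambda>u. jacobi_dn u m) has_real_derivative - m * jacobi_sn u m * jacobi_cn u m) (at u)"
proof -
  have p: "0 < 1 - m * (sin (jacobi_am u m))\<^sup>2"
    using one_minus_sin_pos[OF assms] .
  \<comment> \<open>The factor \<open>jacobi_dn u m\<close> contributed by the amplitude cancels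
    against the root in the denominator of the derivative of \<open>sqrt\<close>.\<close>
  have "((\<lambda>u. 1 - m * (sin (jacobi_am u m))\<^sup>2) has_real_derivative
      - (m * (2 * sin (jacobi_am u m) * (cos (jacobi_am u m) * jacobi_dn u m)))) (at u)"
    by (auto intro!: derivative_eq_intros jacobi_am_has_derivative[OF assms])
  from DERIV_chain2[OF DERIV_real_sqrt[OF p] this] show ?thesis
    using p by (simp add: jacobi_sn_def jacobi_cn_def jacobi_dn_def field_simps)
qed

lemma jacobi_sn_has_derivative:
  assumes "0 \<le> m" "m < 1"
  shows "((\<lambda>u. jacobi_sn u m) has_real_derivative jacobi_cn u m * jacobi_dn u m) (at u)"
  unfolding jacobi_sn_def jacobi_cn_def
  by (rule derivative_eq_intros jacobi_am_has_derivative[OF assms] refl)+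

lemma jacobi_cn_has_derivative:
  assumes "0 \<le> m" "m < 1"
  shows "((\<lambda>u. jacobi_cn u m) has_real_derivative - (jacobi_sn u m * jacobi_dn u m)) (at u)"
  unfolding jacobi_sn_def jacobi_cn_def
  by (rule derivative_eq_intros jacobi_am_has_derivative[OF assms] refl)+ simp

text \<open>A point of the unit circle has an angle, and the elliptic integral of that angle is an
  argument whose amplitude is the angle again.\<close>

lemma ex_jacobi_phase:
  assumes "0 \<le> m" "m < 1" "x\<^sup>2 + y\<^sup>2 = 1"
  shows "\<exists>u. jacobi_sn u m = x \<and> jacobi_cn u m = y"
proof -
  obtain \<phi> where "y = cos \<phi>" "x = sin \<phi>"
    using sincos_total_2pi[of y x] assms(3) by (metis add.commute)
  then show ?thesis
    by (intro exI[of _ "elliptic_F m \<phi>"])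
      (simp add: jacobi_sn_def jacobi_cn_def jacobi_am_elliptic_F[OF assms(1,2)])
qed

section \<open>The system for f, g, h\<close>

text \<open>The system is symmetric in \<open>g\<close> and \<open>h\<close>; this yields the second
  invariant from the first and reduces the case \<open>R_fh < R_fg\<close> to the opposite
  one.\<close>

lemma fgh_solution_swap: "fgh_solution J f g h \<Longrightarrow> fgh_solution J f h g"
  by (simp add: fgh_solution_def mult.commute)

lemma fgh_solution_subset: "fgh_solution J f g h \<Longrightarrow> K \<subseteq> J \<Longrightarrow> fgh_solution K f g h"
  unfolding fgh_solution_def by (meson DERIV_subset subsetD)

section \<open>Conserved quantities and uniqueness\<close>

lemma fgh_solution_conserved:
  assumes J: "is_interval J" "0 \<in> J" and sol: "fgh_solution J f g h"
  shows "fgh_conserved J f g h"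
proof -
  \<comment> \<open>Stated for arbitrary functions shadowing the fixed ones, so that it also applies
    with \<open>g\<close> and \<open>h\<close> exchanged. The derivative vanishes because the two
    terms \<open>2 * f t * g t * h t\<close> cancel.\<close>
  have const: "(f t)\<^sup>2 + (g t)\<^sup>2 = (f 0)\<^sup>2 + (g 0)\<^sup>2"
    if "t \<in> J" "fgh_solution J f g h" for t f g h
  proof -
    have "((\<lambda>t. (f t)\<^sup>2 + (g t)\<^sup>2) has_real_derivative 0) (at t within J)" if "t \<in> J" for t
    proof -
      have "(f has_real_derivative g t * h t) (at t within J)"
        "(g has_real_derivative - (f t * h t)) (at t within J)"
        using \<open>fgh_solution J f g h\<close> that by (auto simp: fgh_solution_def)
      then show ?thesis
        by (auto intro!: derivative_eq_intros)
    qed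
    from has_field_derivative_zero_constant[OF is_interval_convex[OF J(1)] this]
    show ?thesis using that(1) J(2) by auto
  qed
  show ?thesis
    using const[OF _ sol] const[OF _ fgh_solution_swap[OF sol]] by (simp add: fgh_conserved_def)
qed

text \<open>A Gronwall argument in both time directions: the bound makes
  \<open>E s * exp (K * s)\<close> nondecreasing and \<open>E s * exp (- K * s)\<close>
  nonincreasing. The first is compared with its value 0 at time 0 when \<open>t < 0\<close>, the
  second when \<open>t > 0\<close>.\<close>

lemma gronwall_zero:
  fixes E E' :: "real \<Rightarrow> real"
  assumes J: "is_interval J" "0 \<in> J" "t \<in> J"
    and der: "\<And>s. s \<in> J \<Longrightarrow> (E has_real_derivative E' s) (at s within J)"
    and bound: "\<And>s. s \<in> J \<Longrightarrow> \<bar>E' s\<bar> \<le> K * E s"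
    and E: "E 0 = 0" "0 \<le> E t"
  shows "E t = 0"
proof -
  \<comment> \<open>Restricting to \<open>{a..b}\<close> allows the mean value theorem even when an
    end of \<open>J\<close> is reached, where only a one-sided derivative is given.\<close>
  have deriv: "((\<lambda>s. E s * exp (k * s)) has_derivative (*) ((E' s + k * E s) * exp (k * s)))
      (at s within {a..b})" if "s \<in> {a..b}" "a \<in> J" "b \<in> J" for a b k s
  proof -
    have "{a..b} \<subseteq> J"
      using mem_is_interval_1_I[OF J(1) that(2,3)] by auto
    then have "(E has_real_derivative E' s) (at s within {a..b})"
      using der that DERIV_subset by blast
    then have "((\<lambda>s. E s * exp (k * s)) has_real_derivative (E' s + k * E s) * exp (k * s))
        (at s within {a..b})"
      by (auto intro!: derivative_eq_intros simp: algebra_simps)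
    then show ?thesis by (simp add: has_field_derivative_def)
  qed
  have *: "\<exists>s\<in>J. E b * exp (k * b) - E a * exp (k * a) = (E' s + k * E s) * exp (k * s) * (b - a)"
    if ab: "a < b" "a \<in> J" "b \<in> J" for a b k
  proof -
    obtain s where "s \<in> {a<..<b}"
      "E b * exp (k * b) - E a * exp (k * a) = (E' s + k * E s) * exp (k * s) * (b - a)"
      using mvt_simple[OF ab(1) deriv[OF _ ab(2,3), where k = k]] by auto
    moreover then have "s \<in> J"
      using mem_is_interval_1_I[OF J(1) ab(2,3)] by simp
    ultimately show ?thesis by blast
  qed
  have "E t \<le> 0"
  proof (cases t "0 :: real" rule: linorder_cases)
    case less
    have "\<exists>s\<in>J. - (E t * exp (K * t)) = (E' s + K * E s) * exp (K * s) * (- t)"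
      using *[OF less J(3,2), of K] E(1) by simp
    then obtain s where s: "s \<in> J" "- (E t * exp (K * t)) = (E' s + K * E s) * exp (K * s) * (- t)"
      by blast
    have "0 \<le> (E' s + K * E s) * exp (K * s) * (- t)"
      using bound[OF s(1)] less by (intro mult_nonneg_nonneg) auto
    then have "E t * exp (K * t) \<le> 0" using s by linarith
    then show ?thesis by (simp add: mult_le_0_iff)
  next
    case greater
    have "\<exists>s\<in>J. E t * exp (- K * t) = (E' s + - K * E s) * exp (- K * s) * t"
      using *[OF greater J(2,3), of "- K"] E(1) by simp
    then obtain s where s: "s \<in> J" "E t * exp (- K * t) = (E' s + - K * E s) * exp (- K * s) * t"
      by blast
    have "(E' s + - K * E s) * exp (- K * s) * t \<le> 0"
      using bound[OF s(1)] greater by (intro mult_nonpos_nonneg) auto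
    then have "E t * exp (- K * t) \<le> 0" using s by linarith
    then show ?thesis by (simp add: mult_le_0_iff)
  qed (use E in simp)
  with E show ?thesis by simp
qed

lemma fgh_solution_unique:
  assumes J: "is_interval J" "0 \<in> J" "t \<in> J"
    and sol: "fgh_solution J f g h" "fgh_solution J F G H"
    and init: "F 0 = f 0" "G 0 = g 0" "H 0 = h 0"
  shows "f t = F t \<and> g t = G t \<and> h t = H t"
proof -
  define E where "E s = (f s - F s)\<^sup>2 + (g s - G s)\<^sup>2 + (h s - H s)\<^sup>2" for s
  \<comment> \<open>The derivative of \<open>E\<close>, factored: expanding the three products and
    collecting terms leaves only the differences in \<open>g\<close> and \<open>h\<close> times the
    sum \<open>f s + F s\<close>.\<close>
  define E' where "E' s = - 2 * ((g s - G s) * (h s - H s)) * (f s + F s)" for s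
  \<comment> \<open>Both solutions have the same conserved value of the first invariant, so
    \<open>M\<close> bounds both \<open>f\<close> and \<open>F\<close> on \<open>J\<close> and
    \<open>2 * M\<close> serves as the Gronwall constant.\<close>
  define M where "M = sqrt ((f 0)\<^sup>2 + (g 0)\<^sup>2)"
  have "E t = 0"
  proof (rule gronwall_zero[OF J])
    fix s assume s: "s \<in> J"
    have d: "(f has_real_derivative g s * h s) (at s within J)"
      "(g has_real_derivative - (f s * h s)) (at s within J)"
      "(h has_real_derivative - (f s * g s)) (at s within J)"
      "(F has_real_derivative G s * H s) (at s within J)"
      "(G has_real_derivative - (F s * H s)) (at s within J)"
      "(H has_real_derivative - (F s * G s)) (at s within J)"
      using sol s by (auto simp: fgh_solution_def)
    show "(E has_real_derivative E' s) (at s within J)"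
      unfolding E_def[abs_def] E'_def
      by (rule derivative_eq_intros d refl)+ (simp, algebra)
    have "(f s)\<^sup>2 + (g s)\<^sup>2 = (f 0)\<^sup>2 + (g 0)\<^sup>2" "(F s)\<^sup>2 + (G s)\<^sup>2 = (f 0)\<^sup>2 + (g 0)\<^sup>2"
      using fgh_solution_conserved[OF J(1,2) sol(1)] fgh_solution_conserved[OF J(1,2) sol(2)] s init
      by (simp_all add: fgh_conserved_def)
    then have "\<bar>f s\<bar> \<le> M" "\<bar>F s\<bar> \<le> M"
      unfolding M_def by (metis le_add_same_cancel1 real_sqrt_abs real_sqrt_le_mono zero_le_power2)+
    then have "\<bar>f s + F s\<bar> \<le> 2 * M" by linarith
    moreover have "\<bar>2 * ((g s - G s) * (h s - H s))\<bar> \<le> E s"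
    proof -
      have "0 \<le> (\<bar>g s - G s\<bar> - \<bar>h s - H s\<bar>)\<^sup>2" by simp
      then have "2 * (\<bar>g s - G s\<bar> * \<bar>h s - H s\<bar>) \<le> (g s - G s)\<^sup>2 + (h s - H s)\<^sup>2"
        by (simp add: power2_diff)
      then show ?thesis by (simp add: E_def abs_mult add.assoc add_increasing)
    qed
    ultimately have "\<bar>2 * ((g s - G s) * (h s - H s))\<bar> * \<bar>f s + F s\<bar> \<le> E s * (2 * M)"
      by (intro mult_mono) (auto simp: E_def)
    then show "\<bar>E' s\<bar> \<le> 2 * M * E s"
      by (simp add: E'_def abs_mult mult_ac)
  qed (auto simp: E_def init)
  then show ?thesis
    unfolding E_def by (smt (verit) zero_le_power2 power2_eq_iff_nonneg zero_eq_power2)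
qed

section \<open>Explicit solutions\<close>

text \<open>The relation between \<open>A\<close> and \<open>k\<close> is what the third equation
  demands: the derivative of \<open>dn\<close> brings the factor \<open>m * k * k\<close>, the
  product of the first two components the factor \<open>A * A\<close>. The sign of \<open>k\<close>
  is free, which accommodates either sign of \<open>h\<close>.\<close>

lemma fgh_solution_jacobi:
  assumes m: "0 \<le> m" "m < 1" and A: "A\<^sup>2 = m * k\<^sup>2"
  shows "fgh_solution UNIV (\<lambda>t. A * jacobi_sn (k * t + t0) m) (\<lambda>t. A * jacobi_cn (k * t + t0) m)
    (\<lambda>t. k * jacobi_dn (k * t + t0) m)"
proof -
  note d = jacobi_sn_has_derivative[OF m, THEN DERIV_chain2]
    jacobi_cn_has_derivative[OF m, THEN DERIV_chain2]
    jacobi_dn_has_derivative[OF m, THEN DERIV_chain2]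
  have e: "m * (k * k) * z = A * A * z" for z
    using A by (simp add: power2_eq_square)
  show ?thesis
    unfolding fgh_solution_def
    by (auto intro!: derivative_eq_intros d simp: algebra_simps e[simplified algebra_simps])
qed

text \<open>The phase fixes only \<open>sn\<close> and \<open>cn\<close>. Then \<open>dn\<close> is
  the nonnegative root of 1 minus \<open>m\<close> times the square of \<open>sn\<close>, which
  works out to \<open>\<bar>c / R\<bar>\<close>; the factor \<open>sgn c\<close> restores the
  sign.\<close>

lemma jacobi_initial_values:
  assumes "0 < r" "r < R" and r: "r\<^sup>2 = a\<^sup>2 + b\<^sup>2" and R: "R\<^sup>2 = a\<^sup>2 + c\<^sup>2"
    and phase: "jacobi_sn t0 (r\<^sup>2 / R\<^sup>2) = a / r" "jacobi_cn t0 (r\<^sup>2 / R\<^sup>2) = b / r"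
  shows "r * jacobi_sn t0 (r\<^sup>2 / R\<^sup>2) = a" "r * jacobi_cn t0 (r\<^sup>2 / R\<^sup>2) = b"
    "sgn c * R * jacobi_dn t0 (r\<^sup>2 / R\<^sup>2) = c"
proof -
  have "1 - r\<^sup>2 / R\<^sup>2 * (a / r)\<^sup>2 = (c / R)\<^sup>2"
  proof -
    have "1 - r\<^sup>2 / R\<^sup>2 * (a / r)\<^sup>2 = (R\<^sup>2 - a\<^sup>2) / R\<^sup>2"
      using assms(1,2) by (simp add: power_divide diff_divide_distrib)
    then show ?thesis using R by (simp add: power_divide)
  qed
  then have "jacobi_dn t0 (r\<^sup>2 / R\<^sup>2) = \<bar>c / R\<bar>"
    using phase by (simp add: jacobi_dn_def jacobi_sn_def[symmetric])
  then show "sgn c * R * jacobi_dn t0 (r\<^sup>2 / R\<^sup>2) = c"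
    using assms(1,2) by (simp add: mult.commute sgn_mult_abs abs_mult_sgn)
qed (use assms in auto)

section \<open>Hyperbolic solutions\<close>

lemma sech_has_derivative:
  "(sech has_real_derivative - (sech x * tanh x)) (at x)"
  unfolding sech_def[abs_def]
  by (auto intro!: derivative_eq_intros simp: tanh_def power2_eq_square)

lemma tanh_sech_square: "(tanh x)\<^sup>2 + (sech x)\<^sup>2 = 1"
proof -
  have "(tanh x)\<^sup>2 + (sech x)\<^sup>2 = ((sinh x)\<^sup>2 + 1) / (cosh x)\<^sup>2"
    by (simp add: tanh_def sech_def power_divide add_divide_distrib)
  then show ?thesis by (simp flip: cosh_square_eq)
qed

lemma sech_pos: "0 < sech x"
  by (simp add: sech_def)

lemma tanh_artanh:
  fixes x :: real
  assumes "\<bar>x\<bar> < 1"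
  shows "tanh (artanh x) = x"
proof -
  have "exp (- 2 * artanh x) = (1 - x) / (1 + x)"
    using assms by (simp add: artanh_def exp_minus)
  then show ?thesis
    using assms by (simp only: tanh_real_altdef) (simp add: field_simps)
qed

text \<open>The degenerate case m = 1 of the elliptic solutions. The signs \<open>s\<close> and
  \<open>s'\<close> of the last two components are independent, and \<open>f' = g h\<close> forces
  their product into the frequency.\<close>

lemma fgh_solution_hyperbolic:
  assumes "\<bar>s\<bar> = 1" "\<bar>s'\<bar> = 1"
  shows "fgh_solution UNIV (\<lambda>t. R * tanh (s * s' * R * t + t0))
    (\<lambda>t. s * R * sech (s * s' * R * t + t0)) (\<lambda>t. s' * R * sech (s * s' * R * t + t0))"
proof -
  have t: "1 - tanh x * tanh x = sech x * sech x" for x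
    using tanh_sech_square[of x] by (simp add: power2_eq_square)
  have s: "s * s = 1" "s' * s' = 1"
    using assms by (metis abs_mult_self_eq mult_1)+
  then have s': "s * (s * z) = z" "s' * (s' * z) = z" for z
    by (simp_all add: mult.assoc[symmetric])
  show ?thesis
    unfolding fgh_solution_def
    by (auto intro!: derivative_eq_intros sech_has_derivative[THEN DERIV_chain2]
      simp: t mult_ac s' power2_eq_square)
qed

text \<open>Because \<open>b \<noteq> 0\<close>, the quotient \<open>a / R\<close> lies strictly
  between -1 and 1, so \<open>tanh\<close> inverts \<open>artanh\<close> there. Positivity of
  \<open>sech\<close> then singles out \<open>\<bar>b\<bar> / R\<close> as the root of 1 minus the
  square of \<open>tanh\<close>.\<close>

lemma hyperbolic_initial_values:
  assumes "0 < R" "b \<noteq> 0" "R\<^sup>2 = a\<^sup>2 + b\<^sup>2" "\<bar>c\<bar> = \<bar>b\<bar>"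
  shows "R * tanh (artanh (a / R)) = a" "sgn b * R * sech (artanh (a / R)) = b"
    "sgn c * R * sech (artanh (a / R)) = c"
proof -
  have "a\<^sup>2 < R\<^sup>2" using assms by simp
  then have "\<bar>a\<bar> < R" using assms(1) using power2_less_imp_less[of "\<bar>a\<bar>" R] by simp
  then have t: "tanh (artanh (a / R)) = a / R"
    using assms(1) by (intro tanh_artanh) simp
  then show "R * tanh (artanh (a / R)) = a"
    using assms(1) by simp
  have "(sech (artanh (a / R)))\<^sup>2 = (R\<^sup>2 - a\<^sup>2) / R\<^sup>2"
    using tanh_sech_square[of "artanh (a / R)"] t assms(1)
    by (simp add: power_divide diff_divide_distrib)
  then have "(sech (artanh (a / R)))\<^sup>2 = (\<bar>b\<bar> / R)\<^sup>2"
    using assms(3) by (simp add: power_divide)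
  then have "sech (artanh (a / R)) = \<bar>b\<bar> / R"
    using sech_pos assms(1) by (simp add: power2_eq_iff_nonneg less_imp_le)
  then show "sgn b * R * sech (artanh (a / R)) = b" "sgn c * R * sech (artanh (a / R)) = c"
    using assms(1,4) by (simp_all add: sgn_mult_abs) (metis sgn_mult_abs)
qed

text \<open>In every case the claimed formula is a solution on the whole line with the same initial
  value, so uniqueness on \<open>J\<close> identifies it with the given one.\<close>

lemma fgh_solution_explicit_formulas:
  assumes J: "is_interval J" "0 \<in> J" and sol: "fgh_solution J f g h"
  shows "explicit_formulas J f g h"
proof -
  define r where "r = sqrt ((f 0)\<^sup>2 + (g 0)\<^sup>2)"
  define R where "R = sqrt ((f 0)\<^sup>2 + (h 0)\<^sup>2)"
  have r2: "r\<^sup>2 = (f 0)\<^sup>2 + (g 0)\<^sup>2" and R2: "R\<^sup>2 = (f 0)\<^sup>2 + (h 0)\<^sup>2"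
    by (simp_all add: r_def R_def)
  note unique = fgh_solution_unique[OF J _ sol fgh_solution_subset[OF _ subset_UNIV]]
  \<comment> \<open>Vanishing pairwise products are exactly the condition for an equilibrium; this
    serves both cases with constant solutions.\<close>
  have const: "fgh_solution UNIV (\<lambda>_. a) (\<lambda>_. b) (\<lambda>_. c)" if "a * b = 0" "a * c = 0" "b * c = 0"
    for a b c
    using that by (auto simp: fgh_solution_def)
  have 1: "\<forall>t\<in>J. f t = 0 \<and> g t = 0 \<and> h t = h 0" if "r = 0"
  proof -
    have "f 0 = 0" "g 0 = 0" using that r2 by (simp_all add: sum_power2_eq_zero_iff)
    then show ?thesis using unique[OF _ const[of 0 0 "h 0"]] by simp
  qed
  have 2: "h 0 \<noteq> 0 \<and> (\<exists>t0. jacobi_sn t0 (r\<^sup>2 / R\<^sup>2) = f 0 / r \<and> jacobi_cn t0 (r\<^sup>2 / R\<^sup>2) = g 0 / r) \<and>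
      (\<forall>t0. jacobi_sn t0 (r\<^sup>2 / R\<^sup>2) = f 0 / r \<and> jacobi_cn t0 (r\<^sup>2 / R\<^sup>2) = g 0 / r \<longrightarrow>
        (\<forall>t\<in>J. f t = r * jacobi_sn (sgn (h 0) * R * t + t0) (r\<^sup>2 / R\<^sup>2) \<and>
           g t = r * jacobi_cn (sgn (h 0) * R * t + t0) (r\<^sup>2 / R\<^sup>2) \<and>
           h t = sgn (h 0) * R * jacobi_dn (sgn (h 0) * R * t + t0) (r\<^sup>2 / R\<^sup>2)))"
    if "r < R" "0 < r"
  proof -
    have lt: "r\<^sup>2 < R\<^sup>2" using that by (simp add: power_strict_mono)
    then have m: "0 \<le> r\<^sup>2 / R\<^sup>2" "r\<^sup>2 / R\<^sup>2 < 1" using that by auto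
    have "h 0 \<noteq> 0" using lt r2 R2 by auto
    \<comment> \<open>The relation required of amplitude \<open>r\<close> and frequency
      \<open>sgn (h 0) * R\<close>; the sign squares to 1 since
      \<open>h 0 \<noteq> 0\<close>.\<close>
    then have A: "r\<^sup>2 = r\<^sup>2 / R\<^sup>2 * (sgn (h 0) * R)\<^sup>2"
      using that by (simp add: power_mult_distrib sgn_if)
    have "\<exists>t0. jacobi_sn t0 (r\<^sup>2 / R\<^sup>2) = f 0 / r \<and> jacobi_cn t0 (r\<^sup>2 / R\<^sup>2) = g 0 / r"
      using that by (intro ex_jacobi_phase[OF m])
        (simp add: power_divide flip: add_divide_distrib r2)
    then show ?thesis
      using \<open>h 0 \<noteq> 0\<close> unique[OF _ fgh_solution_jacobi[OF m A]]
        jacobi_initial_values[OF that(2,1) r2 R2] by auto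
  qed
  have 3: "\<forall>t\<in>J. f t = f 0 \<and> g t = 0 \<and> h t = 0" if "g 0 = 0" "h 0 = 0"
    using unique[OF _ const[of "f 0" 0 0]] that by simp
  have 4: "\<bar>h 0\<bar> = \<bar>g 0\<bar> \<and> \<bar>g 0\<bar> > 0 \<and>
      (\<forall>t\<in>J. f t = R * tanh (sgn (g 0 * h 0) * R * t + artanh (f 0 / R)) \<and>
         g t = sgn (g 0) * R * sech (sgn (g 0 * h 0) * R * t + artanh (f 0 / R)) \<and>
         h t = sgn (h 0) * R * sech (sgn (g 0 * h 0) * R * t + artanh (f 0 / R)))"
    if "R = r" "0 < r" "g 0 \<noteq> 0"
  proof -
    have "(h 0)\<^sup>2 = (g 0)\<^sup>2" using that r2 R2 by simp
    then have hg: "\<bar>h 0\<bar> = \<bar>g 0\<bar>" by (simp add: abs_eq_iff power2_eq_iff)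
    then have "h 0 \<noteq> 0" using that by auto
    then have "\<bar>sgn (g 0)\<bar> = 1" "\<bar>sgn (h 0)\<bar> = 1" using that by (simp_all add: abs_sgn_eq)
    note sol' = fgh_solution_hyperbolic[OF this, of R "artanh (f 0 / R)"]
    have "0 < R" "R\<^sup>2 = (f 0)\<^sup>2 + (g 0)\<^sup>2" using that r2 by auto
    note init = hyperbolic_initial_values[OF this(1) that(3) this(2) hg]
    show ?thesis
      using that hg unique[OF _ sol'] init by (auto simp: sgn_mult)
  qed
  show ?thesis
    unfolding explicit_formulas_def Let_def r_def[symmetric] R_def[symmetric]
    using 1 2 3 4 by blast
qed

lemma fgh_solution_explicitly_given:
  assumes "is_interval J" "0 \<in> J" "fgh_solution J f g h"
  shows "explicitly_given J f g h"
  unfolding explicitly_given_def Let_def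
  using fgh_solution_explicit_formulas[OF assms(1,2)] assms(3) fgh_solution_swap by blast

text \<open>Global existence is read off from the explicit solutions. It suffices to treat
  \<open>\<bar>b\<bar> \<le> \<bar>c\<bar>\<close>, since swapping the last two components covers
  the rest.\<close>

lemma ex_fgh_solution:
  "\<exists>f g h. fgh_solution UNIV f g h \<and> f 0 = a \<and> g 0 = b \<and> h 0 = c"
proof -
  have *: "\<exists>f g h. fgh_solution UNIV f g h \<and> f 0 = a \<and> g 0 = b \<and> h 0 = c" if "\<bar>b\<bar> \<le> \<bar>c\<bar>" for b c
  proof -
    define r where "r = sqrt (a\<^sup>2 + b\<^sup>2)"
    define R where "R = sqrt (a\<^sup>2 + c\<^sup>2)"
    have r2: "r\<^sup>2 = a\<^sup>2 + b\<^sup>2" and R2: "R\<^sup>2 = a\<^sup>2 + c\<^sup>2"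
      by (simp_all add: r_def R_def)
    have rR0: "0 \<le> r" "0 \<le> R" by (simp_all add: r_def R_def)
    \<comment> \<open>Two kinds of equilibria, then the elliptic and the hyperbolic regime. If
      \<open>r > 0\<close> and \<open>\<bar>b\<bar> = \<bar>c\<bar>\<close>, either both vanish or
      both are nonzero, and the latter gives \<open>0 < R\<close>.\<close>
    consider "a = 0" "b = 0" | "b = 0" "c = 0" | "0 < r" "\<bar>b\<bar> < \<bar>c\<bar>" | "0 < R" "b \<noteq> 0" "\<bar>c\<bar> = \<bar>b\<bar>"
    proof (cases "r = 0")
      case True
      then show ?thesis using r2 that(1) by (simp add: sum_power2_eq_zero_iff)
    next
      case False
      then have "0 < r" using rR0 by simp
      moreover have "0 < R" if "c \<noteq> 0"
        using that by (simp add: R_def add_nonneg_pos)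
      ultimately show ?thesis
        using that \<open>\<bar>b\<bar> \<le> \<bar>c\<bar>\<close> by (metis abs_0_eq abs_eq_0 order_le_less)
    qed
    then show ?thesis
    proof cases
      case 1
      then show ?thesis
        by (intro exI[of _ "\<lambda>_. a"] exI[of _ "\<lambda>_. b"] exI[of _ "\<lambda>_. c"]) (simp add: fgh_solution_def)
    next
      case 2
      then show ?thesis
        by (intro exI[of _ "\<lambda>_. a"] exI[of _ "\<lambda>_. b"] exI[of _ "\<lambda>_. c"]) (simp add: fgh_solution_def)
    next
      case 3
      have "b\<^sup>2 < c\<^sup>2" using 3 by (metis abs_ge_zero power2_abs power_strict_mono zero_less_numeral)
      then have lt: "r\<^sup>2 < R\<^sup>2" using r2 R2 by simp
      then have "r < R" using rR0 by (simp add: power2_less_imp_less)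
      have m: "0 \<le> r\<^sup>2 / R\<^sup>2" "r\<^sup>2 / R\<^sup>2 < 1" using lt 3 \<open>r < R\<close> by auto
      have A: "r\<^sup>2 = r\<^sup>2 / R\<^sup>2 * (sgn c * R)\<^sup>2"
        using 3 \<open>r < R\<close> by (auto simp: power_mult_distrib sgn_if)
      obtain t0 where t0: "jacobi_sn t0 (r\<^sup>2 / R\<^sup>2) = a / r" "jacobi_cn t0 (r\<^sup>2 / R\<^sup>2) = b / r"
        using 3 ex_jacobi_phase[OF m, of "a / r" "b / r"]
        by (auto simp: power_divide simp flip: add_divide_distrib r2)
      show ?thesis
        using fgh_solution_jacobi[OF m A, of t0]
          jacobi_initial_values[OF 3(1) \<open>r < R\<close> r2 R2 t0] by fastforce
    next
      case 4
      have "b\<^sup>2 = c\<^sup>2" using 4 by (metis power2_abs)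
      then have "R\<^sup>2 = a\<^sup>2 + b\<^sup>2" using R2 by simp
      note init = hyperbolic_initial_values[OF 4(1,2) this 4(3)]
      have "\<bar>sgn b\<bar> = 1" "\<bar>sgn c\<bar> = 1" using 4 by (auto simp: abs_sgn_eq)
      from fgh_solution_hyperbolic[OF this, of R "artanh (a / R)"]
      show ?thesis using init by fastforce
    qed
  qed
  show ?thesis
  proof (cases "\<bar>b\<bar> \<le> \<bar>c\<bar>")
    case False
    then show ?thesis using *[of c b] fgh_solution_swap by (metis linorder_linear)
  qed (rule *)
qed

section \<open>The system for D, R, I\<close>

text \<open>All three branches of the triplet are scalings of a permutation of \<open>(D, R, I)\<close>, and the scaling
  factors satisfy the relations that turn one system into the other.\<close>

lemma fgh_triplet_cases:
  assumes "p3 > 0" "\<bar>p2\<bar> \<noteq> p3"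
  obtains \<alpha> \<beta> \<gamma> where "\<alpha> \<noteq> 0" "\<beta> \<noteq> 0" "\<gamma> \<noteq> 0"
    "\<And>x y z. fgh_triplet p2 p3 (x, y, z) = (\<alpha> * x, \<beta> * y, \<gamma> * z)"
    "\<alpha> * (2 * (p2 - p3)) = \<beta> * \<gamma>" "\<beta> * (2 * (p2 + p3)) = \<alpha> * \<gamma>" "\<gamma> * (4 * p3) = - (\<alpha> * \<beta>)"
  | \<alpha> \<beta> \<gamma> where "\<alpha> \<noteq> 0" "\<beta> \<noteq> 0" "\<gamma> \<noteq> 0"
    "\<And>x y z. fgh_triplet p2 p3 (x, y, z) = (\<gamma> * z, \<beta> * y, \<alpha> * x)"
    "\<alpha> * (2 * (p2 - p3)) = - (\<beta> * \<gamma>)" "\<beta> * (2 * (p2 + p3)) = \<alpha> * \<gamma>" "\<gamma> * (4 * p3) = \<alpha> * \<beta>"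
  | \<alpha> \<beta> \<gamma> where "\<alpha> \<noteq> 0" "\<beta> \<noteq> 0" "\<gamma> \<noteq> 0"
    "\<And>x y z. fgh_triplet p2 p3 (x, y, z) = (\<beta> * y, \<alpha> * x, \<gamma> * z)"
    "\<alpha> * (2 * (p2 - p3)) = - (\<beta> * \<gamma>)" "\<beta> * (2 * (p2 + p3)) = - (\<alpha> * \<gamma>)" "\<gamma> * (4 * p3) = - (\<alpha> * \<beta>)"
proof -
  \<comment> \<open>With these three roots every coefficient of the triplet is, up to sign, 2 times
    a product of two of \<open>a\<close>, \<open>b\<close>, \<open>c\<close>, so the relations
    between the scaling factors become identities between monomials.\<close>
  define a where "a = sqrt \<bar>p2 + p3\<bar>"
  define b where "b = sqrt \<bar>p3 - p2\<bar>"
  define c where "c = sqrt (2 * p3)"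
  have abc: "a > 0" "b > 0" "c > 0"
    using assms by (auto simp: a_def b_def c_def)
  have sq: "a\<^sup>2 = \<bar>p2 + p3\<bar>" "b\<^sup>2 = \<bar>p3 - p2\<bar>" "c\<^sup>2 = 2 * p3"
    using assms by (simp_all add: a_def b_def c_def)
  have ca: "sqrt (8 * p3 * \<bar>p2 + p3\<bar>) = 2 * c * a" and cb: "sqrt (8 * p3 * \<bar>p3 - p2\<bar>) = 2 * c * b"
    using abc by (auto intro!: real_sqrt_unique simp: power_mult_distrib sq)
  have ab: "sqrt (\<bar>p2 + p3\<bar> * \<bar>p3 - p2\<bar>) = a * b"
    using abc by (auto intro!: real_sqrt_unique simp: power_mult_distrib sq)
  consider (neg) "p2 < - p3" | (mid) "- p3 < p2" "p2 < p3" | (pos) "p3 < p2"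
    using assms by linarith
  then show ?thesis
  proof cases
    case neg
    have e: "\<bar>p2 + p3\<bar> = - (p2 + p3)" "\<bar>p3 - p2\<bar> = p3 - p2"
      using neg assms by auto
    \<comment> \<open>Both factors are positive in this branch, so the root in the third component
      splits as \<open>a * b\<close>; the other branches use the factorization with their own
      signs.\<close>
    have "p2\<^sup>2 - p3\<^sup>2 = (- (p2 + p3)) * (p3 - p2)"
      by (simp add: algebra_simps power2_eq_square)
    note roots = ca[unfolded e] cb[unfolded e] ab[unfolded e, folded this]
    have t: "fgh_triplet p2 p3 (x, y, z) = ((- 2 * c * a) * x, (2 * c * b) * y, (2 * a * b) * z)"
      for x y z
      using neg assms by (simp only: fgh_triplet_def prod.case roots e if_True if_False) (simp add: roots)
    have p: "p2 + p3 = - a\<^sup>2" "p2 - p3 = - b\<^sup>2" "4 * p3 = 2 * c\<^sup>2"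
      using neg assms by (simp_all add: sq)
    show ?thesis
      by (rule that(1)[OF _ _ _ t]) (use abc in \<open>simp_all add: p power2_eq_square\<close>)
  next
    case mid
    have e: "\<bar>p2 + p3\<bar> = p2 + p3" "\<bar>p3 - p2\<bar> = p3 - p2"
      using mid assms by auto
    have "p3\<^sup>2 - p2\<^sup>2 = (p2 + p3) * (p3 - p2)"
      by (simp add: algebra_simps power2_eq_square)
    note roots = ca[unfolded e] cb[unfolded e] ab[unfolded e, folded this]
    have t: "fgh_triplet p2 p3 (x, y, z) = ((2 * a * b) * z, (2 * c * b) * y, (2 * c * a) * x)"
      for x y z
      using mid assms by (simp only: fgh_triplet_def prod.case roots e if_True if_False) (simp add: roots)
    have p: "p2 + p3 = a\<^sup>2" "p2 - p3 = - b\<^sup>2" "4 * p3 = 2 * c\<^sup>2"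
      using mid assms by (simp_all add: sq)
    show ?thesis
      by (rule that(2)[OF _ _ _ t]) (use abc in \<open>simp_all add: p power2_eq_square\<close>)
  next
    case pos
    have e: "\<bar>p2 + p3\<bar> = p2 + p3" "\<bar>p3 - p2\<bar> = p2 - p3"
      using pos assms by auto
    have "p2\<^sup>2 - p3\<^sup>2 = (p2 + p3) * (p2 - p3)"
      by (simp add: algebra_simps power2_eq_square)
    note roots = ca[unfolded e] cb[unfolded e] ab[unfolded e, folded this]
    have t: "fgh_triplet p2 p3 (x, y, z) = ((- 2 * c * b) * y, (2 * c * a) * x, (2 * a * b) * z)"
      for x y z
      using pos assms by (simp only: fgh_triplet_def prod.case roots e if_True if_False) (simp add: roots)
    have p: "p2 + p3 = a\<^sup>2" "p2 - p3 = b\<^sup>2" "4 * p3 = 2 * c\<^sup>2"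
      using pos assms by (simp_all add: sq)
    show ?thesis
      by (rule that(3)[OF _ _ _ t]) (use abc in \<open>simp_all add: p power2_eq_square\<close>)
  qed
qed

section \<open>Inverting the triplet and transferring solutions\<close>

lemma fgh_triplet_surj:
  assumes "p3 > 0" "\<bar>p2\<bar> \<noteq> p3"
  shows "\<exists>P. fgh_triplet p2 p3 P = Q"
proof -
  obtain f g h where Q: "Q = (f, g, h)" by (metis surj_pair)
  show ?thesis
  proof (cases rule: fgh_triplet_cases[OF assms])
    case (1 \<alpha> \<beta> \<gamma>)
    then show ?thesis by (intro exI[of _ "(f / \<alpha>, g / \<beta>, h / \<gamma>)"]) (simp add: Q)
  next
    case (2 \<alpha> \<beta> \<gamma>)
    then show ?thesis by (intro exI[of _ "(h / \<alpha>, g / \<beta>, f / \<gamma>)"]) (simp add: Q)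
  next
    case (3 \<alpha> \<beta> \<gamma>)
    then show ?thesis by (intro exI[of _ "(g / \<alpha>, f / \<beta>, h / \<gamma>)"]) (simp add: Q)
  qed
qed

lemma fgh_triplet_inj:
  assumes "p3 > 0" "\<bar>p2\<bar> \<noteq> p3" "fgh_triplet p2 p3 P = fgh_triplet p2 p3 Q"
  shows "P = Q"
  using assms(3) by (cases P; cases Q; cases rule: fgh_triplet_cases[OF assms(1,2)]) auto

text \<open>Proportionality is assumed on \<open>J\<close> only, as the triplet ties the two sets of
  functions together only there; a derivative within \<open>J\<close> at a point of \<open>J\<close>
  does not see other values. Keeping \<open>d = c * e\<close> as a premise isolates the
  algebra.\<close>

lemma has_real_derivative_cmult_eq_iff:
  fixes f :: "real \<Rightarrow> real"
  assumes "t \<in> J" "\<And>s. s \<in> J \<Longrightarrow> f s = c * u s" "c \<noteq> 0" "d = c * e"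
  shows "(f has_real_derivative d) (at t within J) \<longleftrightarrow> (u has_real_derivative e) (at t within J)"
proof
  assume "(f has_real_derivative d) (at t within J)"
  then have "((\<lambda>s. f s / c) has_real_derivative d / c) (at t within J)"
    by (rule DERIV_cdivide)
  then show "(u has_real_derivative e) (at t within J)"
    using has_field_derivative_transform_within[of "\<lambda>s. f s / c" _ t J 1 u] assms by simp
next
  assume "(u has_real_derivative e) (at t within J)"
  then have "((\<lambda>s. c * u s) has_real_derivative c * e) (at t within J)"
    by (rule DERIV_cmult)
  then show "(f has_real_derivative d) (at t within J)"
    using has_field_derivative_transform_within[of "\<lambda>s. c * u s" _ t J 1 f] assms by simp
qed

text \<open>Each equation of one system is a nonzero multiple of one equation of the other, paired
  by the permutation of the branch, and the scaling relations match the right-hand sides. One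
  direction shows that the triplet solves its system, the other pulls solutions back.\<close>

lemma fgh_solution_triplet_iff:
  assumes "p3 > 0" "\<bar>p2\<bar> \<noteq> p3"
    and fgh: "\<And>t. t \<in> J \<Longrightarrow> (f t, g t, h t) = fgh_triplet p2 p3 (D t, R t, I t)"
  shows "fgh_solution J f g h \<longleftrightarrow> DRI_solution p2 p3 J D R I"
proof (cases rule: fgh_triplet_cases[OF assms(1,2)])
  case (1 \<alpha> \<beta> \<gamma>)
  have eq: "f s = \<alpha> * D s" "g s = \<beta> * R s" "h s = \<gamma> * I s" if "s \<in> J" for s
    using fgh[OF that] 1(4) by simp_all
  have f: "(f has_real_derivative g t * h t) (at t within J) \<longleftrightarrow>
      (D has_real_derivative 2 * (p2 - p3) * R t * I t) (at t within J)" if t: "t \<in> J" for t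
  proof (rule has_real_derivative_cmult_eq_iff[OF t eq(1) 1(1)])
    show "g t * h t = \<alpha> * (2 * (p2 - p3) * R t * I t)"
      using 1(5) unfolding eq[OF t] by algebra
  qed
  have g: "(g has_real_derivative - (f t * h t)) (at t within J) \<longleftrightarrow>
      (R has_real_derivative - 2 * (p2 + p3) * D t * I t) (at t within J)" if t: "t \<in> J" for t
  proof (rule has_real_derivative_cmult_eq_iff[OF t eq(2) 1(2)])
    show "- (f t * h t) = \<beta> * (- 2 * (p2 + p3) * D t * I t)"
      using 1(6) unfolding eq[OF t] by algebra
  qed
  have h: "(h has_real_derivative - (f t * g t)) (at t within J) \<longleftrightarrow>
      (I has_real_derivative 4 * p3 * D t * R t) (at t within J)" if t: "t \<in> J" for t
  proof (rule has_real_derivative_cmult_eq_iff[OF t eq(3) 1(3)])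
    show "- (f t * g t) = \<gamma> * (4 * p3 * D t * R t)"
      using 1(7) unfolding eq[OF t] by algebra
  qed
  show ?thesis
    using f g h by (auto simp: fgh_solution_def DRI_solution_def)
next
  case (2 \<alpha> \<beta> \<gamma>)
  have eq: "f s = \<gamma> * I s" "g s = \<beta> * R s" "h s = \<alpha> * D s" if "s \<in> J" for s
    using fgh[OF that] 2(4) by simp_all
  have f: "(f has_real_derivative g t * h t) (at t within J) \<longleftrightarrow>
      (I has_real_derivative 4 * p3 * D t * R t) (at t within J)" if t: "t \<in> J" for t
  proof (rule has_real_derivative_cmult_eq_iff[OF t eq(1) 2(3)])
    show "g t * h t = \<gamma> * (4 * p3 * D t * R t)"
      using 2(7) unfolding eq[OF t] by algebra
  qed
  have g: "(g has_real_derivative - (f t * h t)) (at t within J) \<longleftrightarrow>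
      (R has_real_derivative - 2 * (p2 + p3) * D t * I t) (at t within J)" if t: "t \<in> J" for t
  proof (rule has_real_derivative_cmult_eq_iff[OF t eq(2) 2(2)])
    show "- (f t * h t) = \<beta> * (- 2 * (p2 + p3) * D t * I t)"
      using 2(6) unfolding eq[OF t] by algebra
  qed
  have h: "(h has_real_derivative - (f t * g t)) (at t within J) \<longleftrightarrow>
      (D has_real_derivative 2 * (p2 - p3) * R t * I t) (at t within J)" if t: "t \<in> J" for t
  proof (rule has_real_derivative_cmult_eq_iff[OF t eq(3) 2(1)])
    show "- (f t * g t) = \<alpha> * (2 * (p2 - p3) * R t * I t)"
      using 2(5) unfolding eq[OF t] by algebra
  qed
  show ?thesis
    using f g h by (auto simp: fgh_solution_def DRI_solution_def)
next
  case (3 \<alpha> \<beta> \<gamma>)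
  have eq: "f s = \<beta> * R s" "g s = \<alpha> * D s" "h s = \<gamma> * I s" if "s \<in> J" for s
    using fgh[OF that] 3(4) by simp_all
  have f: "(f has_real_derivative g t * h t) (at t within J) \<longleftrightarrow>
      (R has_real_derivative - 2 * (p2 + p3) * D t * I t) (at t within J)" if t: "t \<in> J" for t
  proof (rule has_real_derivative_cmult_eq_iff[OF t eq(1) 3(2)])
    show "g t * h t = \<beta> * (- 2 * (p2 + p3) * D t * I t)"
      using 3(6) unfolding eq[OF t] by algebra
  qed
  have g: "(g has_real_derivative - (f t * h t)) (at t within J) \<longleftrightarrow>
      (D has_real_derivative 2 * (p2 - p3) * R t * I t) (at t within J)" if t: "t \<in> J" for t
  proof (rule has_real_derivative_cmult_eq_iff[OF t eq(2) 3(1)])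
    show "- (f t * h t) = \<alpha> * (2 * (p2 - p3) * R t * I t)"
      using 3(5) unfolding eq[OF t] by algebra
  qed
  have h: "(h has_real_derivative - (f t * g t)) (at t within J) \<longleftrightarrow>
      (I has_real_derivative 4 * p3 * D t * R t) (at t within J)" if t: "t \<in> J" for t
  proof (rule has_real_derivative_cmult_eq_iff[OF t eq(3) 3(3)])
    show "- (f t * g t) = \<gamma> * (4 * p3 * D t * R t)"
      using 3(7) unfolding eq[OF t] by algebra
  qed
  show ?thesis
    using f g h by (auto simp: fgh_solution_def DRI_solution_def)
qed

lemma ex_DRI_solution:
  assumes "p3 > 0" "\<bar>p2\<bar> \<noteq> p3"
  shows "\<exists>D R I. DRI_solution p2 p3 UNIV D R I \<and> (D 0, R 0, I 0) = P"
proof -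
  obtain a b c where abc: "fgh_triplet p2 p3 P = (a, b, c)" by (metis surj_pair)
  obtain f g h where sol: "fgh_solution UNIV f g h" and init: "f 0 = a" "g 0 = b" "h 0 = c"
    using ex_fgh_solution by blast
  have "\<exists>P. fgh_triplet p2 p3 P = (f t, g t, h t)" for t
    by (rule fgh_triplet_surj[OF assms])
  \<comment> \<open>A pointwise choice of preimages suffices: differentiability of the components
    comes from the equivalence of the two systems.\<close>
  then obtain X where X: "\<And>t. fgh_triplet p2 p3 (X t) = (f t, g t, h t)" by metis
  define D R I where "D t = fst (X t)" and "R t = fst (snd (X t))" and "I t = snd (snd (X t))" for t
  have DRI: "(D t, R t, I t) = X t" for t
    by (simp add: D_def R_def I_def)
  have "DRI_solution p2 p3 UNIV D R I"
    using fgh_solution_triplet_iff[OF assms, of UNIV f g h D R I] sol X DRI by simp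
  \<comment> \<open>Injectivity of the triplet map makes the chosen preimage at time 0 the
    prescribed point.\<close>
  moreover have "X 0 = P"
    using fgh_triplet_inj[OF assms] X abc init by metis
  ultimately show ?thesis using DRI by metis
qed

text \<open>The squared radius has derivative proportional to \<open>D t * R t * I t\<close>, with
  coefficients that cancel: \<open>2 * (p2 - p3) - 2 * (p2 + p3) + 4 * p3 = 0\<close>.\<close>

lemma DRI_solution_in_S2:
  assumes sol: "DRI_solution p2 p3 J D R I" and J: "is_interval J" "0 \<in> J" "t \<in> J"
    and init: "(D 0, R 0, I 0) \<in> S2 \<rho>"
  shows "(D t, R t, I t) \<in> S2 \<rho>"
proof -
  have "((\<lambda>t. (D t)\<^sup>2 + (R t)\<^sup>2 + (I t)\<^sup>2) has_real_derivative 0) (at t within J)" if "t \<in> J" for t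
  proof -
    have "(D has_real_derivative 2 * (p2 - p3) * R t * I t) (at t within J)"
      "(R has_real_derivative - 2 * (p2 + p3) * D t * I t) (at t within J)"
      "(I has_real_derivative 4 * p3 * D t * R t) (at t within J)"
      using sol that by (auto simp: DRI_solution_def)
    then show ?thesis
      by (auto intro!: derivative_eq_intros simp: algebra_simps)
  qed
  from has_field_derivative_zero_constant[OF is_interval_convex[OF J(1)] this]
  have "(D t)\<^sup>2 + (R t)\<^sup>2 + (I t)\<^sup>2 = (D 0)\<^sup>2 + (R 0)\<^sup>2 + (I 0)\<^sup>2"
    using J(2,3) by auto
  then show ?thesis using init by (simp add: S2_def)
qed

theorem proposition2p11:
  fixes p2 p3 \<rho> :: real
  assumes "p2 \<noteq> 0" and "p3 > 0" and "\<bar>p2\<bar> \<noteq> p3" and "\<rho> > 0"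
  shows
    "(\<forall>P\<in>axis_points \<rho>. P \<in> S2 \<rho> \<and> DRI_fixed_point p2 p3 P) \<and>
     (\<forall>P\<in>S2 \<rho> - axis_points \<rho>. \<exists>D R I.
        DRI_solution p2 p3 UNIV D R I \<and> (D 0, R 0, I 0) = P \<and>
        (\<forall>t. (D t, R t, I t) \<in> S2 \<rho>)) \<and>
     (\<forall>J D R I f g h.
        is_interval J \<and> 0 \<in> J \<and>
        DRI_solution p2 p3 J D R I \<and>
        (D 0, R 0, I 0) \<in> S2 \<rho> - axis_points \<rho> \<and>
        (\<forall>t\<in>J. (f t, g t, h t) = fgh_triplet p2 p3 (D t, R t, I t)) \<longrightarrow>
          fgh_solution J f g h \<and> explicitly_given J f g h \<and> fgh_conserved J f g h) \<and>
     (\<forall>J f g h.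
        is_interval J \<and> 0 \<in> J \<and> fgh_solution J f g h \<longrightarrow>
          explicitly_given J f g h \<and> fgh_conserved J f g h)"
proof (intro conjI ballI allI impI; (elim conjE)?)
  fix P assume "P \<in> axis_points \<rho>"
  \<comment> \<open>Every right-hand side is a product of two different coordinates, and at an axis
    point at most one coordinate is nonzero.\<close>
  then show "P \<in> S2 \<rho>" "DRI_fixed_point p2 p3 P"
    by (auto simp: axis_points_def S2_def DRI_fixed_point_def DRI_solution_def)
next
  fix P assume "P \<in> S2 \<rho> - axis_points \<rho>"
  moreover obtain D R I where "DRI_solution p2 p3 UNIV D R I" "(D 0, R 0, I 0) = P"
    using ex_DRI_solution[OF assms(2,3)] by blast
  ultimately show "\<exists>D R I. DRI_solution p2 p3 UNIV D R I \<and> (D 0, R 0, I 0) = P \<and>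
      (\<forall>t. (D t, R t, I t) \<in> S2 \<rho>)"
    using DRI_solution_in_S2[of p2 p3 UNIV D R I] by blast
next
  fix J D R I f g h
  assume "DRI_solution p2 p3 J D R I" "is_interval J" "0 \<in> J"
    "\<forall>t\<in>J. (f t, g t, h t) = fgh_triplet p2 p3 (D t, R t, I t)"
  moreover from this show "fgh_solution J f g h"
    using fgh_solution_triplet_iff[OF assms(2,3)] by blast
  ultimately show "explicitly_given J f g h" "fgh_conserved J f g h"
    using fgh_solution_explicitly_given fgh_solution_conserved by blast+
qed (use fgh_solution_explicitly_given fgh_solution_conserved in blast)+

end
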